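(* Let $k\geq 2$ and $s_1,\ldots, s_t \geq k + 1$. Then for $q = (s_1 - k + 1)\cdots (s_t - k + 1)$, we have $$r_{k -1}(\lfloor n/q\rfloor ;q) \le r_k(P_{s_1}, \ldots, P_{s_t}, n) \le r_{k -1}(n;q).$$
   Context: All hypergraphs are on the ordered vertex set $[N]=\{1,\ldots,N\}$. For a $k$-uniform hypergraph $H$ on $[N]$, a tight path of size $s$, denoted $P^{(k)}_s$, is a set of $s$ vertices $v_1<\cdots<v_s$ in $[N]$ such that $\{v_j,v_{j+1},\ldots,v_{j+k-1}\}\in E(H)$ for $j=1,\ldots,s-k+1$; its length is $s-k+1$. $K^{(k)}_n$ denotes the complete $k$-uniform hypergraph on $n$ vertices. The $q$-color Ramsey number $r_{k-1}(n;q)=r_{k-1}(n,\ldots,n)$ ($q$ times) is the minimum $N$ such that every $q$-coloring of the $(k-1)$-element subsets of $[N]$ contains a set of $n$ vertices all of whose $(k-1)$-subsets have the same color (a monochromatic $K^{(k-1)}_n$). The number $r_k(P_{s_1},\ldots,P_{s_t},n)=r(P^{(k)}_{s_1},\ldots,P^{(k)}_{s_t},K^{(k)}_n)$ is the minimum $N$ such that every $(t+1)$-coloring of the $k$-element subsets of $[N]$ contains, for some $i\le t$, a tight path $P^{(k)}_{s_i}$ all of whose edges have color $i$, or a copy of $K^{(k)}_n$ all of whose edges have color $t+1$. *)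

theory Defs
  imports Complex_Main "HOL-Library.Ramsey"
begin

text \<open>
  A \<open>k\<close>-uniform hypergraph on the vertex set \<open>{1..N}\<close> is given by its edge set
  \<open>E \<subseteq> nsets {1..N} k\<close>. The vertices \<open>v 1 < \<dots> < v s\<close> form a tight path of size \<open>s\<close>
  if each of the \<open>s - k + 1\<close> windows of \<open>k\<close> consecutive vertices is an edge; the number of
  windows is written \<open>s + 1 - k\<close> so that it is \<open>0\<close> whenever \<open>s < k\<close>.
\<close>

definition tight_path :: "nat \<Rightarrow> nat \<Rightarrow> nat set set \<Rightarrow> nat \<Rightarrow> (nat \<Rightarrow> nat) \<Rightarrow> bool"
  where "tight_path k N E s v \<longleftrightarrow>
    strict_mono_on {1..s} v \<and> v ` {1..s} \<subseteq> {1..N} \<and>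
    (\<forall>j\<in>{1..s + 1 - k}. v ` {j..<j + k} \<in> E)"

definition colour_class :: "nat \<Rightarrow> nat \<Rightarrow> (nat set \<Rightarrow> nat) \<Rightarrow> nat \<Rightarrow> nat set set"
  where "colour_class k N f i = {e \<in> nsets {1..N} k. f e = i}"

definition ramsey_number :: "nat \<Rightarrow> nat \<Rightarrow> nat \<Rightarrow> nat"
  where "ramsey_number r n q = (LEAST N. partn {1..N} n r {1..q})"

definition path_clique_partn :: "nat \<Rightarrow> nat \<Rightarrow> nat \<Rightarrow> (nat \<Rightarrow> nat) \<Rightarrow> nat \<Rightarrow> bool"
  where "path_clique_partn N k t s n \<longleftrightarrow>
    (\<forall>f \<in> nsets {1..N} k \<rightarrow> {1..t + 1}.
       (\<exists>i\<in>{1..t}. \<exists>v. tight_path k N (colour_class k N f i) (s i) v) \<or>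
       monochromatic {1..N} n k f (t + 1))"

text \<open>Only the values \<open>s 1, \<dots>, s t\<close> matter.\<close>

definition path_ramsey_number :: "nat \<Rightarrow> nat \<Rightarrow> (nat \<Rightarrow> nat) \<Rightarrow> nat \<Rightarrow> nat"
  where "path_ramsey_number k t s n = (LEAST N. path_clique_partn N k t s n)"

text \<open>Both minima exist, so neither \<open>LEAST\<close> is a junk value.\<close>

lemma ramsey_from_one:
  "\<exists>N::nat. \<forall>f \<in> nsets {1..N} r \<rightarrow> {1..length qs}.
     \<exists>i\<in>{1..length qs}. monochromatic {1..N} (qs ! (i - 1)) r f i"
proof -
  obtain N :: nat where N: "partn_lst {..<N} qs r"
    using ramsey_full by blast
  have "\<exists>i\<in>{1..length qs}. monochromatic {1..N} (qs ! (i - 1)) r f i"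
    if f: "f \<in> nsets {1..N} r \<rightarrow> {1..length qs}" for f
  proof -
    have shift: "Suc ` X \<in> nsets {1..N} m" if "X \<in> nsets {..<N} m" for X m
      using that by (auto simp: nsets_def card_image)
    define g where "g = (\<lambda>X. f (Suc ` X) - 1)"
    have "g \<in> nsets {..<N} r \<rightarrow> {..<length qs}"
    proof
      fix X assume "X \<in> nsets {..<N} r"
      then have "f (Suc ` X) \<in> {1..length qs}"
        using f shift by blast
      then show "g X \<in> {..<length qs}"
        by (auto simp: g_def)
    qed
    then obtain i H where i: "i < length qs" and H: "H \<in> nsets {..<N} (qs ! i)"
      and mono: "g ` nsets H r \<subseteq> {i}"
      using N unfolding partn_lst_def monochromatic_def by blast
    have "f Y = Suc i" if Y: "Y \<in> nsets (Suc ` H) r" for Y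
    proof -
      obtain X where X: "X \<subseteq> H" "Y = Suc ` X"
        using Y by (auto simp: nsets_def subset_image_iff)
      then have "X \<in> nsets H r"
        using Y by (auto simp: nsets_def card_image finite_image_iff)
      moreover have "X \<in> nsets {..<N} r"
        using \<open>X \<in> nsets H r\<close> H by (auto simp: nsets_def)
      ultimately have "f (Suc ` X) - 1 = i" "f (Suc ` X) \<in> {1..length qs}"
        using mono f shift unfolding g_def by blast+
      then show ?thesis
        using X by auto
    qed
    then have "monochromatic {1..N} (qs ! (Suc i - 1)) r f (Suc i)"
      unfolding monochromatic_def using shift[OF H] by auto
    then show ?thesis
      using i by (intro bexI[of _ "Suc i"]) auto
  qed
  then show ?thesis by blast
qed

lemma ramsey_number_attained: "partn {1..ramsey_number r n q} n r {1..q}"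
proof -
  obtain N :: nat where N: "\<And>f. f \<in> nsets {1..N} r \<rightarrow> {1..q} \<Longrightarrow>
      \<exists>i\<in>{1..q}. monochromatic {1..N} (replicate q n ! (i - 1)) r f i"
    using ramsey_from_one[of r "replicate q n"] by auto
  have "partn {1..N} n r {1..q}"
    unfolding partn_def
  proof
    fix f :: "nat set \<Rightarrow> nat" assume "f \<in> nsets {1..N} r \<rightarrow> {1..q}"
    from N[OF this] obtain i where "i \<in> {1..q}"
      "monochromatic {1..N} (replicate q n ! (i - 1)) r f i" by blast
    then show "\<exists>i\<in>{1..q}. monochromatic {1..N} n r f i"
      by (intro bexI[of _ i]) auto
  qed
  then show ?thesis
    unfolding ramsey_number_def by (rule LeastI)
qed

lemma monochromatic_imp_tight_path:
  assumes "monochromatic {1..N} s k f i"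
  shows "\<exists>v. tight_path k N (colour_class k N f i) s v"
proof -
  obtain H where H: "H \<subseteq> {1..N}" "finite H" "card H = s"
    and mono: "f ` nsets H k \<subseteq> {i}"
    using assms by (auto simp: monochromatic_def nsets_def)
  define v where "v = (\<lambda>j. sorted_list_of_set H ! (j - 1))"
  have sm: "strict_mono_on {1..s} v"
  proof (rule strict_mono_onI)
    fix a b assume "a \<in> {1..s}" "b \<in> {1..s}" "a < b"
    then show "v a < v b"
      using H strict_sorted_list_of_set[of H]
      by (auto simp: v_def sorted_wrt_iff_nth_less)
  qed
  have vH: "v ` {1..s} \<subseteq> H"
  proof
    fix x assume "x \<in> v ` {1..s}"
    then obtain j where "j \<in> {1..s}" "x = v j" by blast
    then have "x \<in> set (sorted_list_of_set H)"
      using H by (auto simp: v_def simp del: set_sorted_list_of_set intro!: nth_mem)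
    then show "x \<in> H"
      using H by simp
  qed
  have "v ` {j..<j + k} \<in> colour_class k N f i" if "j \<in> {1..s + 1 - k}" for j
  proof -
    have sub: "{j..<j + k} \<subseteq> {1..s}"
      using that by auto
    have "inj_on v {j..<j + k}"
      using strict_mono_on_imp_inj_on[OF sm] sub inj_on_subset by blast
    then have "v ` {j..<j + k} \<in> nsets H k"
      using sub vH by (auto simp: nsets_def card_image)
    then show ?thesis
      using mono H nsets_mono[OF H(1)] unfolding colour_class_def by blast
  qed
  then show ?thesis
    unfolding tight_path_def using sm vH H by blast
qed

lemma path_ramsey_number_attained:
  "path_clique_partn (path_ramsey_number k t s n) k t s n"
proof -
  define qs where "qs = map s [1..<t + 1] @ [n]"
  have len: "length qs = t + 1"
    by (simp add: qs_def)
  obtain N :: nat where N: "\<And>f. f \<in> nsets {1..N} k \<rightarrow> {1..t + 1} \<Longrightarrow>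
      \<exists>i\<in>{1..t + 1}. monochromatic {1..N} (qs ! (i - 1)) k f i"
    using ramsey_from_one[of k qs] unfolding len by blast
  have "path_clique_partn N k t s n"
    unfolding path_clique_partn_def
  proof
    fix f :: "nat set \<Rightarrow> nat" assume "f \<in> nsets {1..N} k \<rightarrow> {1..t + 1}"
    from N[OF this] obtain i where i: "i \<in> {1..t + 1}"
      and mono: "monochromatic {1..N} (qs ! (i - 1)) k f i" by blast
    show "(\<exists>i\<in>{1..t}. \<exists>v. tight_path k N (colour_class k N f i) (s i) v) \<or>
        monochromatic {1..N} n k f (t + 1)"
    proof (cases "i = t + 1")
      case True
      then have "qs ! (i - 1) = n"
        by (simp add: qs_def nth_append)
      then show ?thesis
        using mono True by simp
    next
      case False
      then have "i \<in> {1..t}"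
        using i by auto
      moreover from this have "qs ! (i - 1) = s i"
        by (auto simp: qs_def nth_append simp del: upt_Suc)
      ultimately show ?thesis
        using mono monochromatic_imp_tight_path[of N "s i" k f i] by metis
    qed
  qed
  then show ?thesis
    unfolding path_ramsey_number_def by (rule LeastI)
qed

end

theory Submission
  imports Defs
begin

text \<open>
  Put \<open>m = k - 1\<close> and identify the \<open>q\<close> colours of \<open>m\<close>-sets with the vectors in a box with sides
  \<open>{0..s i - k}\<close>. For the upper bound, colour an \<open>m\<close>-set \<open>S\<close> by the vector of the lengths of the
  longest tight paths in colours \<open>1, \<dots>, t\<close> that end in \<open>S\<close>: an edge of colour \<open>i \<le> t\<close> strictly
  increases coordinate \<open>i\<close> from its first \<open>m\<close> vertices to its last \<open>m\<close> ones, so a monochromatic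
  set only spans edges of colour \<open>t + 1\<close>.

  For the lower bound, give an edge the colour \<open>i\<close> of a coordinate that increases from its first
  \<open>m\<close> vertices to its last \<open>m\<close> ones, and colour \<open>t + 1\<close> if there is none. Along a path of
  size \<open>s i\<close> in colour \<open>i\<close>, coordinate \<open>i\<close> would take \<open>s i - k + 2\<close> values, one too many. On a
  clique of colour \<open>t + 1\<close>, let \<open>B x\<close> be the coordinatewise maximum over the \<open>m\<close>-sets with
  minimum \<open>x\<close>. Sliding a window shows that the vector of \<open>S\<close> lies between \<open>B (Max S)\<close> and
  \<open>B (Min S)\<close>, so each of the \<open>q\<close> fibres of \<open>B\<close> is monochromatic.
\<close>

section \<open>Windows and fibres\<close>

lemma set_remove_Min_Max:
  fixes xs :: "'a::linorder list"
  assumes "sorted_wrt (<) xs" "xs \<noteq> []"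
  shows "set xs - {Min (set xs)} = set (tl xs)" "set xs - {Max (set xs)} = set (butlast xs)"
proof -
  obtain y ys where "xs = y # ys" using assms by (cases xs) auto
  moreover from this have "Min (set xs) = y"
    using assms by (intro Min_eqI) (auto intro: less_imp_le)
  ultimately show "set xs - {Min (set xs)} = set (tl xs)"
    using assms by auto
  obtain z zs where zs: "xs = zs @ [z]" using assms by (cases xs rule: rev_cases) auto
  moreover from this have "Max (set xs) = z"
    using assms by (intro Max_eqI) (auto simp: sorted_wrt_append intro: less_imp_le)
  ultimately show "set xs - {Max (set xs)} = set (butlast xs)"
    using assms by (auto simp: sorted_wrt_append)
qed

text \<open>Links the two descriptions of an overlap: dropping an extreme vertex of an edge
  \<open>e\<close> is the same as moving between consecutive \<open>m\<close>-windows of a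
  path.\<close>

lemma window_remove_Min_Max:
  fixes v :: "nat \<Rightarrow> 'a::linorder"
  assumes "strict_mono_on {j..<j + Suc m} v"
  shows "v ` {j..<j + Suc m} - {Min (v ` {j..<j + Suc m})} = v ` {Suc j..<Suc j + m}"
    "v ` {j..<j + Suc m} - {Max (v ` {j..<j + Suc m})} = v ` {j..<j + m}"
proof -
  have "sorted_wrt (<) (map v [j..<j + Suc m])"
    using assms unfolding sorted_wrt_map
    by (intro sorted_wrt_mono_rel[OF _ sorted_wrt_upt]) (auto simp: strict_mono_on_def)
  note * = set_remove_Min_Max[OF this]
  have tl: "tl (map v [j..<j + Suc m]) = map v [Suc j..<Suc j + m]"
    by (simp add: map_tl [symmetric] del: upt_Suc)
  have bl: "butlast (map v [j..<j + Suc m]) = map v [j..<j + m]"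
    by (simp add: map_butlast [symmetric])
  show "v ` {j..<j + Suc m} - {Min (v ` {j..<j + Suc m})} = v ` {Suc j..<Suc j + m}"
    "v ` {j..<j + Suc m} - {Max (v ` {j..<j + Suc m})} = v ` {j..<j + m}"
    using * unfolding tl bl by (simp_all del: upt_Suc)
qed

text \<open>The first \<open>Suc m\<close> entries form an edge whose two extreme
  \<open>m\<close>-subsets are the first two windows, so \<open>step\<close> compares these.
  Dropping the head and inducting reaches the last window; with exactly \<open>m\<close> entries the
  first and last windows coincide.\<close>

lemma sliding_window_antimono:
  fixes c :: "'a::linorder set \<Rightarrow> 'b::preorder"
  assumes step: "\<And>e. e \<in> nsets H (Suc m) \<Longrightarrow> c (e - {Min e}) \<le> c (e - {Max e})"
    and "sorted_wrt (<) xs" "set xs \<subseteq> H" "m \<le> length xs"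
  shows "c (set (drop (length xs - m) xs)) \<le> c (set (take m xs))"
  using assms(2-)
proof (induction xs)
  case Nil
  then show ?case by simp
next
  case (Cons x ys)
  show ?case
  proof (cases "m \<le> length ys")
    case False
    then show ?thesis using Cons.prems by (simp add: not_le Suc_le_eq)
  next
    case True
    define zs where "zs = take (Suc m) (x # ys)"
    have sorted: "sorted_wrt (<) zs"
      unfolding zs_def using Cons.prems(1) by (rule sorted_wrt_take)
    have len: "length zs = Suc m" using True by (simp add: zs_def)
    have "set zs \<subseteq> H" using Cons.prems(2) set_take_subset[of "Suc m" "x # ys"] unfolding zs_def by (rule order_trans[rotated])
    moreover have "distinct zs" using sorted by (simp add: strict_sorted_iff)
    ultimately have "set zs \<in> nsets H (Suc m)"
      using len by (auto simp: nsets_def distinct_card)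
    from step[OF this] have "c (set (tl zs)) \<le> c (set (butlast zs))"
      using set_remove_Min_Max[OF sorted] len by fastforce
    moreover have "tl zs = take m ys" "butlast zs = take m (x # ys)"
      using True by (auto simp: zs_def butlast_take take_Cons split: nat.split)
    ultimately have "c (set (take m ys)) \<le> c (set (take m (x # ys)))" by simp
    moreover have "c (set (drop (length ys - m) ys)) \<le> c (set (take m ys))"
      using Cons True by auto
    ultimately show ?thesis
      using True by (simp add: Suc_diff_le) (meson order_trans)
  qed
qed

lemma sliding_window_touching:
  fixes c :: "'a::linorder set \<Rightarrow> 'b::preorder"
  assumes step: "\<And>e. e \<in> nsets H (Suc m) \<Longrightarrow> c (e - {Min e}) \<le> c (e - {Max e})"
    and S: "S \<in> nsets H m" and T: "T \<in> nsets H m" and touch: "Max S = Min T" and m: "m \<ge> 1"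
  shows "c T \<le> c S"
proof -
  define xs where "xs = sorted_list_of_set S"
  define ys where "ys = sorted_list_of_set T"
  have set: "set xs = S" "set ys = T"
    using S T by (auto simp: xs_def ys_def nsets_def)
  have sorted: "sorted_wrt (<) xs" "sorted_wrt (<) ys"
    by (auto simp: xs_def ys_def)
  have len: "length xs = m" "length ys = m"
    using S T by (auto simp: xs_def ys_def nsets_def)
  obtain as a where xs: "xs = as @ [a]" using len m by (cases xs rule: rev_cases) auto
  obtain b bs where ys: "ys = b # bs" using len m by (cases ys) auto
  have "Max S = a"
    using sorted xs set[symmetric]
    by (intro Max_eqI) (auto simp: sorted_wrt_append intro: less_imp_le)
  moreover have "Min T = b"
    using sorted ys set[symmetric] by (intro Min_eqI) (auto intro: less_imp_le)
  ultimately have ab: "a = b" using touch by simp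
  \<comment> \<open>The two lists are glued at their shared vertex \<open>a = b\<close>, which is
    kept only as the head of \<open>ys\<close>. Thus \<open>S\<close> is the first window and
    \<open>T\<close> the last.\<close>
  have "sorted_wrt (<) (as @ ys)"
    using sorted xs ys ab by (fastforce simp: sorted_wrt_append)
  moreover have "set (as @ ys) \<subseteq> H"
    using S T set xs by (auto simp: nsets_def)
  ultimately have "c (set (drop (length (as @ ys) - m) (as @ ys))) \<le> c (set (take m (as @ ys)))"
    using len by (intro sliding_window_antimono[of H m c] step) auto
  moreover have "drop (length (as @ ys) - m) (as @ ys) = ys" using len by simp
  moreover have "take m (as @ ys) = xs" using len xs ys ab by auto
  ultimately show ?thesis unfolding set(1)[symmetric] set(2)[symmetric] by metis
qed

text \<open>Pigeonhole with rounding: if every fibre were smaller than the floor, the total would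
  fall below \<open>card Y * (card H div card Y)\<close>, hence below \<open>card H\<close>.\<close>

lemma large_fibre:
  assumes "finite H" "finite Y" "Y \<noteq> {}" "B ` H \<subseteq> Y"
  shows "\<exists>y\<in>Y. card H div card Y \<le> card {x \<in> H. B x = y}"
proof (rule ccontr)
  assume "\<not> ?thesis"
  then have "card {x \<in> H. B x = y} < card H div card Y" if "y \<in> Y" for y
    using that by auto
  then have "(\<Sum>y\<in>Y. card {x \<in> H. B x = y}) < (\<Sum>y\<in>Y. card H div card Y)"
    using assms by (intro sum_strict_mono) auto
  also have "(\<Sum>y\<in>Y. card {x \<in> H. B x = y}) = card H"
    using sum_fun_comp[OF assms(1,2,4), of "\<lambda>_. 1::nat"] by simp
  also have "(\<Sum>y\<in>Y. card H div card Y) \<le> card H"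
    by simp
  finally show False by simp
qed

section \<open>Tight paths ending in a given set\<close>

text \<open>Here \<open>a\<close> is the number of edges of the path, so its size is \<open>a + m\<close>.\<close>

definition ends_path :: "nat \<Rightarrow> nat \<Rightarrow> nat set set \<Rightarrow> nat set \<Rightarrow> nat \<Rightarrow> bool"
  where "ends_path m N E S a \<longleftrightarrow>
    (\<exists>v. tight_path (Suc m) N E (a + m) v \<and> v ` {Suc a..<Suc a + m} = S)"

text \<open>A path on \<open>m\<close> vertices has no window to check. This keeps the set of path
  lengths ending in \<open>S\<close> nonempty, so that its maximum is meaningful.\<close>

lemma ends_path_0:
  assumes "S \<in> nsets {1..N} m"
  shows "ends_path m N E S 0"
proof -
  define xs where "xs = sorted_list_of_set S"
  define v where "v = (\<lambda>j. xs ! (j - 1))"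
  have len: "length xs = m" and set: "set xs = S" and S: "S \<subseteq> {1..N}"
    using assms by (auto simp: xs_def nsets_def)
  have "v ` {1..m} = S"
  proof -
    have "v ` {1..m} = (!) xs ` ((\<lambda>j. j - 1) ` {1..m})"
      by (simp add: v_def image_image)
    also have "(\<lambda>j. j - 1) ` {1..m} = {0..<m}"
      using image_minus_const_atLeastLessThan_nat[of 1 1 "Suc m"]
      by (auto simp: atLeastLessThanSuc_atLeastAtMost)
    finally show ?thesis using len set nth_image[of m xs] by (simp add: atLeast0LessThan)
  qed
  moreover have "strict_mono_on {1..m} v"
  proof (rule strict_mono_onI)
    fix x y assume "x \<in> {1..m}" "y \<in> {1..m}" "x < y"
    then show "v x < v y"
      using strict_sorted_list_of_set[of S] len
      by (auto simp: v_def xs_def sorted_wrt_iff_nth_less)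
  qed
  ultimately show ?thesis
    using S by (auto simp: ends_path_def tight_path_def atLeastLessThanSuc_atLeastAtMost)
qed

text \<open>An initial segment of a tight path is again a tight path, so \<open>s - m\<close> or
  more edges would yield one of size \<open>s\<close>.\<close>

lemma ends_path_less:
  assumes "ends_path m N E S a" "m < s" "\<nexists>v. tight_path (Suc m) N E s v"
  shows "a < s - m"
proof (rule ccontr)
  assume "\<not> a < s - m"
  then have "s \<le> a + m" by simp
  moreover obtain v where "tight_path (Suc m) N E (a + m) v"
    using assms(1) by (auto simp: ends_path_def)
  ultimately have "tight_path (Suc m) N E s v"
    unfolding tight_path_def by (auto intro: monotone_on_subset)
  then show False using assms(3) by blast
qed

text \<open>Appending \<open>Max e\<close> to the path makes \<open>e\<close> its new last edge, and
  the last \<open>m\<close> vertices become \<open>e - {Min e}\<close>.\<close>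

lemma ends_path_Suc:
  assumes path: "ends_path m N E (e - {Max e}) a" and e: "e \<in> E" "e \<in> nsets {1..N} (Suc m)"
    and m: "m \<ge> 1"
  shows "ends_path m N E (e - {Min e}) (Suc a)"
proof -
  obtain v where v: "tight_path (Suc m) N E (a + m) v" "v ` {Suc a..<Suc a + m} = e - {Max e}"
    using path by (auto simp: ends_path_def)
  have e': "finite e" "e \<noteq> {}" "e \<subseteq> {1..N}" using e by (auto simp: nsets_def)
  then have Max: "Max e \<in> e" by simp
  define w where "w = v(Suc (a + m) := Max e)"
  have same: "w ` A = v ` A" if "Suc (a + m) \<notin> A" for A
    using that by (auto simp: w_def)
  \<comment> \<open>As \<open>m \<ge> 1\<close>, the old endpoint lies in the last window, that is
    in \<open>e - {Max e}\<close>.\<close>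
  have last: "v (a + m) < Max e"
  proof -
    have "v (a + m) \<in> v ` {Suc a..<Suc a + m}" using m by (intro imageI) auto
    then have "v (a + m) \<in> e - {Max e}" using v(2) by simp
    then show ?thesis using e' by (simp add: order.not_eq_order_implies_strict)
  qed
  have mono_v: "strict_mono_on {1..a + m} v" using v(1) by (simp add: tight_path_def)
  have mono_w: "strict_mono_on {1..Suc a + m} w"
  proof (rule strict_mono_onI)
    fix x y assume xy: "x \<in> {1..Suc a + m}" "y \<in> {1..Suc a + m}" "x < y"
    have "v x \<le> v (a + m)" if "x \<le> a + m"
      using strict_mono_on_leD[OF mono_v, of x "a + m"] xy that by auto
    moreover have "v x < v y" if "y \<le> a + m"
      using strict_mono_onD[OF mono_v, of x y] xy that by auto
    ultimately show "w x < w y" using xy last by (auto simp: w_def)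
  qed
  have img: "w ` {Suc a..<Suc a + Suc m} = e"
  proof -
    have "{Suc a..<Suc a + Suc m} = insert (Suc (a + m)) {Suc a..<Suc a + m}" by auto
    then have "w ` {Suc a..<Suc a + Suc m} = insert (Max e) (v ` {Suc a..<Suc a + m})"
      using same[of "{Suc a..<Suc a + m}"] by (simp only: image_insert) (simp add: w_def)
    then show ?thesis using v(2) Max by auto
  qed
  have "strict_mono_on {Suc a..<Suc a + Suc m} w"
    using mono_w by (rule monotone_on_subset) auto
  from window_remove_Min_Max(1)[OF this]
  have "w ` {Suc (Suc a)..<Suc (Suc a) + m} = e - {Min e}" unfolding img by simp
  moreover have "tight_path (Suc m) N E (Suc a + m) w"
    unfolding tight_path_def
  proof (intro conjI ballI)
    show "strict_mono_on {1..Suc a + m} w" by (rule mono_w)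
    have "w ` {1..Suc a + m} \<subseteq> insert (Max e) (v ` {1..a + m})"
      by (auto simp: w_def)
    also have "\<dots> \<subseteq> {1..N}"
      using v(1) subsetD[OF e'(3) Max] by (simp add: tight_path_def)
    finally show "w ` {1..Suc a + m} \<subseteq> {1..N}" .
    fix j assume j: "j \<in> {1..Suc a + m + 1 - Suc m}"
    show "w ` {j..<j + Suc m} \<in> E"
    proof (cases "j = Suc a")
      case True
      then show ?thesis using img e by simp
    next
      case False
      then have "j \<in> {1..a + m + 1 - Suc m}" using j by auto
      then show ?thesis using same[of "{j..<j + Suc m}"] v(1)
        by (auto simp: tight_path_def)
    qed
  qed
  ultimately show ?thesis unfolding ends_path_def by blast
qed

section \<open>The two bounds\<close>

text \<open>Extensional functions make each vector a single element, so the box can be counted and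
  put in bijection with the colours.\<close>

definition box :: "nat \<Rightarrow> (nat \<Rightarrow> nat) \<Rightarrow> (nat \<Rightarrow> nat) set"
  where "box t l = (\<Pi>\<^sub>E i\<in>{1..t}. {..l i})"

lemma box_enumeration:
  assumes "q = (\<Prod>i = 1..t. (l i + 1))"
  obtains h where "bij_betw h (box t l) {1..q}"
proof -
  have "card (box t l) = card {1..q}"
    using assms by (simp add: box_def card_PiE)
  then show ?thesis
    using that finite_same_card_bij[of "box t l" "{1..q}"] by (auto simp: box_def finite_PiE)
qed

lemma path_clique_partn_if_partn:
  assumes m: "m \<ge> 1" and s: "\<And>i. i \<in> {1..t} \<Longrightarrow> s i > Suc m"
    and q: "q = (\<Prod>i = 1..t. (s i - Suc m + 1))" and part: "partn {1..N} n m {1..q}"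
  shows "path_clique_partn N (Suc m) t s n"
  unfolding path_clique_partn_def
proof
  fix f :: "nat set \<Rightarrow> nat" assume f: "f \<in> nsets {1..N} (Suc m) \<rightarrow> {1..t + 1}"
  let ?E = "colour_class (Suc m) N f"
  show "(\<exists>i\<in>{1..t}. \<exists>v. tight_path (Suc m) N (?E i) (s i) v) \<or>
       monochromatic {1..N} n (Suc m) f (t + 1)"
  proof (rule disjCI)
    assume no_clique: "\<not> monochromatic {1..N} n (Suc m) f (t + 1)"
    show "\<exists>i\<in>{1..t}. \<exists>v. tight_path (Suc m) N (?E i) (s i) v"
    proof (rule ccontr)
      assume no: "\<not> ?thesis"
      obtain h where h: "bij_betw h (box t (\<lambda>i. s i - Suc m)) {1..q}"
        using box_enumeration q by blast
      define P where "P = (\<lambda>i. ends_path m N (?E i))"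
      \<comment> \<open>On \<open>m\<close>-sets and coordinates in \<open>{1..t}\<close> this
        \<open>Max\<close> is genuine: the absence of long paths bounds the lengths, and length 0
        always occurs.\<close>
      define g where "g = (\<lambda>S i. Max {a. P i S a})"
      define G where "G = (\<lambda>S. restrict (g S) {1..t})"
      have bound: "a \<le> s i - Suc m" if "P i S a" "i \<in> {1..t}" for i S a
        using ends_path_less[of m N "?E i" S a "s i"] that s[of i] no
        unfolding P_def by fastforce
      have fin: "finite {a. P i S a}" if "i \<in> {1..t}" for i S
        using bound that by (auto intro!: finite_subset[of _ "{..s i - Suc m}"])
      have ex: "P i S (g S i)" if "i \<in> {1..t}" "S \<in> nsets {1..N} m" for i S
        using Max_in[OF fin[OF that(1), of S]] ends_path_0[OF that(2), of "?E i"]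
        unfolding g_def P_def by blast
      have G: "G S \<in> box t (\<lambda>i. s i - Suc m)" if "S \<in> nsets {1..N} m" for S
        unfolding G_def box_def using bound[OF ex[OF _ that]] by fastforce
      have "(\<lambda>S. h (G S)) \<in> nsets {1..N} m \<rightarrow> {1..q}"
        using G h by (auto simp: bij_betw_def)
      then obtain c H where H: "H \<in> nsets {1..N} n" "(\<lambda>S. h (G S)) ` nsets H m \<subseteq> {c}"
        using part unfolding partn_def monochromatic_def by blast
      have HN: "H \<subseteq> {1..N}" using H by (auto simp: nsets_def)
      have "f e = t + 1" if e: "e \<in> nsets H (Suc m)" for e
      proof (rule ccontr)
        assume "f e \<noteq> t + 1"
        moreover have eN: "e \<in> nsets {1..N} (Suc m)" using e nsets_mono[OF HN] by blast
        ultimately have i: "f e \<in> {1..t}" using f by fastforce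
        have "finite e" "e \<noteq> {}" using e by (auto simp: nsets_def)
        then have "Min e \<in> e" "Max e \<in> e" by auto
        then have "e - {Max e} \<in> nsets H m" "e - {Min e} \<in> nsets H m"
          using e by (auto simp: nsets_def)
        moreover from this have "e - {Max e} \<in> nsets {1..N} m" "e - {Min e} \<in> nsets {1..N} m"
          using nsets_mono[OF HN] by blast+
        \<comment> \<open>Both sets are \<open>m\<close>-subsets of \<open>H\<close>, so they share
          a colour, and injectivity of \<open>h\<close> turns this into equality of vectors.\<close>
        ultimately have "G (e - {Max e}) = G (e - {Min e})"
          using H(2) G h by (intro inj_onD[OF bij_betw_imp_inj_on[OF h]]) blast+
        then have eq: "g (e - {Max e}) (f e) = g (e - {Min e}) (f e)"
          using i unfolding G_def by (metis restrict_apply')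
        have "P (f e) (e - {Max e}) (g (e - {Max e}) (f e))"
          using i \<open>e - {Max e} \<in> nsets {1..N} m\<close> by (rule ex)
        moreover have "e \<in> ?E (f e)" using eN by (simp add: colour_class_def)
        ultimately have "P (f e) (e - {Min e}) (Suc (g (e - {Max e}) (f e)))"
          using ends_path_Suc eN m unfolding P_def by blast
        then have "Suc (g (e - {Max e}) (f e)) \<le> g (e - {Min e}) (f e)"
          using fin[OF i] unfolding g_def by (intro Max_ge) auto
        then show False using eq by simp
      qed
      then have "monochromatic {1..N} n (Suc m) f (t + 1)"
        using H(1) unfolding monochromatic_def by blast
      then show False using no_clique by blast
    qed
  qed
qed

lemma partn_if_path_clique_partn:
  assumes m: "m \<ge> 1" and s: "\<And>i. i \<in> {1..t} \<Longrightarrow> s i > Suc m"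
    and q: "q = (\<Prod>i = 1..t. (s i - Suc m + 1))"
    and part: "path_clique_partn N (Suc m) t s n"
  shows "partn {1..N} (n div q) m {1..q}"
  unfolding partn_def
proof
  fix \<phi> :: "nat set \<Rightarrow> nat" assume \<phi>: "\<phi> \<in> nsets {1..N} m \<rightarrow> {1..q}"
  define Y where "Y = box t (\<lambda>i. s i - Suc m)"
  have Y: "finite Y" "Y \<noteq> {}" "card Y = q"
    using q by (auto simp: Y_def box_def finite_PiE card_PiE PiE_eq_empty_iff)
  obtain h where h: "bij_betw h Y {1..q}"
    using box_enumeration q unfolding Y_def by blast
  define c where "c = (\<lambda>S. the_inv_into Y h (\<phi> S))"
  have hc: "h (c S) = \<phi> S" and cY: "c S \<in> Y" if "S \<in> nsets {1..N} m" for S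
  proof -
    have "\<phi> S \<in> h ` Y" using \<phi> that h by (auto simp: bij_betw_def)
    then show "h (c S) = \<phi> S" "c S \<in> Y"
      using h unfolding c_def bij_betw_def by (auto simp: f_the_inv_into_f the_inv_into_into)
  qed
  have c_le: "c S i \<le> s i - Suc m" if "S \<in> nsets {1..N} m" "i \<in> {1..t}" for S i
    using cY[OF that(1)] that(2) by (auto simp: Y_def box_def PiE_def Pi_def)
  define R where "R = (\<lambda>e i. i \<in> {1..t} \<and> c (e - {Max e}) i < c (e - {Min e}) i)"
  \<comment> \<open>Several coordinates may increase; any choice among them works, since only
    \<open>R e (\<chi> e)\<close> is used. The value \<open>t + 1\<close> cannot be such a choice
    because \<open>R\<close> confines \<open>i\<close> to \<open>{1..t}\<close>.\<close>
  define \<chi> where "\<chi> = (\<lambda>e. if \<exists>i. R e i then SOME i. R e i else t + 1)"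
  have \<chi>R: "R e (\<chi> e)" if "\<chi> e \<noteq> t + 1" for e
    using that someI_ex[of "R e"] unfolding \<chi>_def by presburger
  have \<chi>_clique: "\<not> R e i" if "\<chi> e = t + 1" for e i
  proof
    assume "R e i"
    then have "\<chi> e = (SOME i. R e i)" by (auto simp: \<chi>_def)
    then have "R e (\<chi> e)" using \<open>R e i\<close> by (simp add: someI[of "R e"])
    then show False using that by (simp add: R_def)
  qed
  have "\<chi> e \<in> {1..t + 1}" for e
    using \<chi>R[of e] by (cases "\<chi> e = t + 1") (auto simp: R_def)
  then have "\<chi> \<in> nsets {1..N} (Suc m) \<rightarrow> {1..t + 1}" by blast
  then consider i v where "i \<in> {1..t}" "tight_path (Suc m) N (colour_class (Suc m) N \<chi> i) (s i) v"
    | "monochromatic {1..N} n (Suc m) \<chi> (t + 1)"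
    using part unfolding path_clique_partn_def by blast
  then show "\<exists>i\<in>{1..q}. monochromatic {1..N} (n div q) m \<phi> i"
  proof cases
    case 1
    have mono: "strict_mono_on {1..s i} v" and sub: "v ` {1..s i} \<subseteq> {1..N}"
      and edge: "\<And>j. j \<in> {1..s i - m} \<Longrightarrow> v ` {j..<j + Suc m} \<in> colour_class (Suc m) N \<chi> i"
      using 1(2) by (auto simp: tight_path_def)
    have grow: "j \<le> c (v ` {Suc j..<Suc j + m}) i" if "j \<le> s i - m" for j
      using that
    proof (induction j)
      case 0
      then show ?case by simp
    next
      case (Suc j)
      let ?e = "v ` {Suc j..<Suc j + Suc m}"
      have "\<chi> ?e = i"
        using edge[of "Suc j"] Suc.prems by (simp add: colour_class_def)
      then have "R ?e i" using \<chi>R[of ?e] 1(1) by auto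
      moreover have "strict_mono_on {Suc j..<Suc j + Suc m} v"
        using mono by (rule monotone_on_subset) (use Suc.prems in auto)
      note window_remove_Min_Max[OF this]
      ultimately have "c (v ` {Suc j..<Suc j + m}) i < c (v ` {Suc (Suc j)..<Suc (Suc j) + m}) i"
        unfolding R_def by simp
      then show ?case using Suc by simp
    qed
    \<comment> \<open>These are the last \<open>m\<close> vertices of the path. By
      \<open>grow\<close> coordinate \<open>i\<close> is at least \<open>s i - m\<close> there, one
      more than the box allows.\<close>
    let ?S = "v ` {Suc (s i - m)..<Suc (s i - m) + m}"
    have range: "{Suc (s i - m)..<Suc (s i - m) + m} \<subseteq> {1..s i}" using s[OF 1(1)] by auto
    then have "inj_on v {Suc (s i - m)..<Suc (s i - m) + m}"
      using strict_mono_on_imp_inj_on[OF mono] inj_on_subset by blast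
    then have "?S \<in> nsets {1..N} m"
      using sub range by (auto simp: nsets_def card_image)
    then have "c ?S i \<le> s i - Suc m" using c_le 1(1) by blast
    then have False using grow[of "s i - m"] s[OF 1(1)] by simp
    then show ?thesis ..
  next
    case 2
    then obtain H where H: "H \<in> nsets {1..N} n" "\<chi> ` nsets H (Suc m) \<subseteq> {t + 1}"
      unfolding monochromatic_def by blast
    have HN: "H \<subseteq> {1..N}" and finH: "finite H" and cardH: "card H = n"
      using H(1) by (auto simp: nsets_def)
    have nsets_HN: "S \<in> nsets {1..N} m" if "S \<in> nsets H m" for S
      using nsets_mono[OF HN] that by blast
    have step: "c (e - {Min e}) i \<le> c (e - {Max e}) i"
      if "e \<in> nsets H (Suc m)" "i \<in> {1..t}" for e i
    proof -
      have "\<chi> e = t + 1" using H(2) that(1) by blast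
      from \<chi>_clique[OF this, of i] show ?thesis using that(2) by (simp add: R_def)
    qed
    \<comment> \<open>The inserted \<open>0\<close> is the value at the top vertices, which are the minimum of no \<open>m\<close>-set.\<close>
    define W where "W = (\<lambda>x i. insert 0 ((\<lambda>T. c T i) ` {T \<in> nsets H m. Min T = x}))"
    define B where "B = (\<lambda>x. \<lambda>i\<in>{1..t}. Max (W x i))"
    have finW: "finite (W x i)" for x i
      using finH by (auto simp: W_def finite_imp_finite_nsets)
    have W_le: "w \<le> s i - Suc m" if "w \<in> W x i" "i \<in> {1..t}" for w x i
      using that c_le nsets_HN by (auto simp: W_def)
    have "B x \<in> Y" for x
      unfolding Y_def box_def
    proof (rule PiE_I)
      fix i assume i: "i \<in> {1..t}"
      have "Max (W x i) \<in> W x i" using finW by (intro Max_in) (auto simp: W_def)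
      then show "B x i \<in> {..s i - Suc m}" using W_le i by (simp add: B_def)
    qed (auto simp: B_def)
    then obtain y where y: "y \<in> Y" "n div q \<le> card {x \<in> H. B x = y}"
      using large_fibre[OF finH Y(1,2), of B] cardH Y(3) by auto
    \<comment> \<open>The fibre may be too large, so it is trimmed to exactly \<open>n div q\<close>
      vertices.\<close>
    obtain A where A: "A \<subseteq> {x \<in> H. B x = y}" "card A = n div q" "finite A"
      using obtain_subset_with_card_n[OF y(2)] by blast
    have "\<phi> S = h y" if S: "S \<in> nsets A m" for S
    proof -
      have S_H: "S \<in> nsets H m" using S A(1) nsets_mono[of A H] by blast
      have "finite S" "S \<noteq> {}" using S m by (auto simp: nsets_def)
      then have "Min S \<in> A" "Max S \<in> A" using S Min_in Max_in by (auto simp: nsets_def)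
      then have B: "B (Min S) = y" "B (Max S) = y" using A(1) by auto
      have "c S = y"
      proof (rule PiE_ext)
        show "c S \<in> (\<Pi>\<^sub>E i\<in>{1..t}. {..s i - Suc m})" "y \<in> (\<Pi>\<^sub>E i\<in>{1..t}. {..s i - Suc m})"
          using cY[OF nsets_HN[OF S_H]] y(1) by (auto simp: Y_def box_def)
        fix i assume i: "i \<in> {1..t}"
        \<comment> \<open>\<open>S\<close> itself is among the sets over which
          \<open>B (Min S)\<close> takes its maximum.\<close>
        have "c S i \<le> Max (W (Min S) i)"
          using finW S_H by (intro Max_ge) (auto simp: W_def)
        then have "c S i \<le> y i" using B(1) i by (auto simp: B_def)
        \<comment> \<open>Every \<open>T\<close> with minimum \<open>Max S\<close> touches
          \<open>S\<close>, so sliding from \<open>S\<close> to \<open>T\<close> gives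
          \<open>c T i \<le> c S i\<close>. As \<open>B\<close> agrees at \<open>Min S\<close> and
          \<open>Max S\<close>, the two bounds pin \<open>c S\<close> to \<open>y\<close>.\<close>
        moreover have "Max (W (Max S) i) \<le> c S i"
        proof (rule Max.boundedI)
          fix w assume "w \<in> W (Max S) i"
          then consider "w = 0" | T where "T \<in> nsets H m" "Min T = Max S" "w = c T i"
            by (auto simp: W_def)
          then show "w \<le> c S i"
          proof cases
            case (2 T)
            then show ?thesis
              using sliding_window_touching[of H m "\<lambda>S. c S i" S T] step[OF _ i] S_H m by simp
          qed simp
        qed (use finW in \<open>auto simp: W_def\<close>)
        then have "y i \<le> c S i" using B(2) i by (auto simp: B_def)
        ultimately show "c S i = y i" by simp
      qed
      then show ?thesis using hc[OF nsets_HN[OF S_H]] by simp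
    qed
    moreover have "A \<in> nsets {1..N} (n div q)" using A HN by (auto simp: nsets_def)
    ultimately have "monochromatic {1..N} (n div q) m \<phi> (h y)"
      unfolding monochromatic_def by blast
    moreover have "h y \<in> {1..q}" using h y(1) by (auto simp: bij_betw_def)
    ultimately show ?thesis by blast
  qed
qed

theorem theorem2:
  fixes k t n q :: nat and s :: "nat \<Rightarrow> nat"
  assumes "k \<ge> 2"
    and "t \<ge> 1"
    and "\<And>i. i \<in> {1..t} \<Longrightarrow> s i \<ge> k + 1"
    and "q = (\<Prod>i = 1..t. (s i - k + 1))"
  shows "ramsey_number (k - 1) (n div q) q \<le> path_ramsey_number k t s n
    \<and> path_ramsey_number k t s n \<le> ramsey_number (k - 1) n q"
proof -
  obtain m where k: "k = Suc m" and m: "m \<ge> 1"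
    using assms(1) by (cases k) auto
  have s: "s i > Suc m" if "i \<in> {1..t}" for i
    using assms(3)[OF that] k by simp
  have q: "q = (\<Prod>i = 1..t. (s i - Suc m + 1))"
    using assms(4) k by simp
  \<comment> \<open>Since each minimum is attained, transferring the partition property at that one
    value bounds the other \<open>LEAST\<close>.\<close>
  have "ramsey_number m (n div q) q \<le> path_ramsey_number (Suc m) t s n"
    unfolding ramsey_number_def
    using partn_if_path_clique_partn[OF m s q path_ramsey_number_attained] by (rule Least_le)
  moreover have "path_ramsey_number (Suc m) t s n \<le> ramsey_number m n q"
    unfolding path_ramsey_number_def
    using path_clique_partn_if_partn[OF m s q ramsey_number_attained] by (rule Least_le)
  ultimately show ?thesis
    using k by simp
qed

end
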